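(* Let $W\subseteq\mathbb{K}^E$ be a realization of a matroid $\mathsf{M}$, and let $0\ne\varphi\in W^\vee$. Let $W_\varphi:=\ker\varphi\subseteq\mathbb{K}^E$. Then $$\psi_{W_\varphi}=\sum_{\substack{S\subseteq E\\|S|=\operatorname{rk}\mathsf{M}-1}}\Big(\sum_{e\in E\setminus S}\pm\tilde\varphi_e\cdot\det\alpha_{W,S\cup\{e\}}\Big)^2x^S,$$ where $\tilde\varphi=(\tilde\varphi_e)_{e\in E}\in(\mathbb{K}^E)^\vee$ is any lift of $\varphi$ (i.e. $\tilde\varphi|_W=\varphi$, $\tilde\varphi_e=\tilde\varphi(e)$) and the signs are determined by a Laplace expansion, namely $\pm=(-1)^{|\{s\in S\,:\,s<e\}|}$ for a fixed linear order on $E$.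
   Context: $\mathbb{K}$ is a field and $E$ a finite set with a fixed linear order, regarded as the standard basis of $\mathbb{K}^E$, with coordinates $x_e=e^\vee$; $x^S=\prod_{e\in S}x_e$; $V^\vee=\operatorname{Hom}_{\mathbb{K}}(V,\mathbb{K})$. A subspace $W\subseteq\mathbb{K}^E$ (a configuration) is a realization of the matroid $\mathsf{M}$ on $E$ if the independent sets of $\mathsf{M}$ are exactly the $S\subseteq E$ such that the family $(e^\vee|_W)_{e\in S}$ is linearly independent in $W^\vee$. Then $r:=\dim W=\operatorname{rk}\mathsf{M}$; every configuration realizes a unique matroid. Fix a basis $w^1,\dots,w^r$ of $W$ (equivalently, up to scalar, an isomorphism $\mathbb{K}\cong\bigwedge^rW$) and put $w^i_e=e^\vee(w^i)$. For $S\subseteq E$ with $|S|=r$, $\det\alpha_{W,S}:=\det\big((w^i_e)_{1\le i\le r,\ e\in S}\big)$, with columns ordered by the order on $E$; this is the determinant of the composition $\alpha_{W,S}:W\hookrightarrow\mathbb{K}^E\to\mathbb{K}^S$. The configuration polynomial is $\psi_W=\sum_B(\det\alpha_{W,B})^2x^B$, the sum over all bases $B$ of $\mathsf{M}$ (equal to $1$ if $r=0$). It is well defined only up to multiplication by $c^2$ with $c\in\mathbb{K}^*$; whenever configuration polynomials occur in a formula, the formula is meant to hold for a suitable choice of these factors. *)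

theory Defs
  imports
    "HOL-Library.Poly_Mapping"
    "Jordan_Normal_Form.Determinant"
    "HOL-Analysis.Cartesian_Space"
begin

text \<open>The ground set \<open>E\<close> is a finite linearly ordered type \<open>'e\<close>, and \<open>\<K>\<^sup>E\<close> is \<open>'k^'e\<close>.
  Both the Cartesian space type and the matrix library use the symbol \<open>$\<close>;
  here it means the coordinate of a vector in \<open>'k^'e\<close>.\<close>

no_notation Matrix.vec_index (infixl \<open>$\<close> 100)

locale matroid =
  fixes indep :: "'e::finite set \<Rightarrow> bool"
  assumes indep_empty: "indep {}"
    and indep_subset: "indep T \<Longrightarrow> S \<subseteq> T \<Longrightarrow> indep S"
    and augment: "indep S \<Longrightarrow> indep T \<Longrightarrow> card S < card T \<Longrightarrow> \<exists>e\<in>T - S. indep (insert e S)"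

definition matroid_bases :: "('e::finite set \<Rightarrow> bool) \<Rightarrow> 'e set set" where
  "matroid_bases indep = {B. indep B \<and> (\<forall>S. indep S \<longrightarrow> B \<subseteq> S \<longrightarrow> S = B)}"

definition matroid_rank :: "('e::finite set \<Rightarrow> bool) \<Rightarrow> nat" where
  "matroid_rank indep = Max (card ` {S. indep S})"

text \<open>Linear independence in \<open>W\<^sup>\<or>\<close> of the family of restricted coordinate functions
  \<open>(e\<^sup>\<or>|\<^sub>W)\<close>, \<open>e \<in> S\<close>. It is independence of a family: two different indices giving the same
  functional make it dependent.\<close>

definition config_indep :: "('k::field ^ 'e::finite) set \<Rightarrow> 'e set \<Rightarrow> bool" where
  "config_indep W S \<longleftrightarrow>
     (\<forall>c. (\<forall>w\<in>W. (\<Sum>e\<in>S. c e * w $ e) = 0) \<longrightarrow> (\<forall>e\<in>S. c e = 0))"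

definition realizes :: "('k::field ^ 'e::finite) set \<Rightarrow> ('e set \<Rightarrow> bool) \<Rightarrow> bool" where
  "realizes W M \<longleftrightarrow> vec.subspace W \<and> matroid M \<and> (\<forall>S. M S \<longleftrightarrow> config_indep W S)"

text \<open>An element of \<open>W\<^sup>\<or>\<close> is represented by any function that is linear on \<open>W\<close>; its values
  outside \<open>W\<close> are irrelevant.\<close>

definition dual :: "('k::field ^ 'e::finite) set \<Rightarrow> ('k ^ 'e \<Rightarrow> 'k) set" where
  "dual W = {\<phi>. (\<forall>u\<in>W. \<forall>v\<in>W. \<phi> (u + v) = \<phi> u + \<phi> v) \<and> (\<forall>c. \<forall>u\<in>W. \<phi> (c *s u) = c * \<phi> u)}"

definition ker_on :: "('k::field ^ 'e::finite) set \<Rightarrow> ('k ^ 'e \<Rightarrow> 'k) \<Rightarrow> ('k ^ 'e) set" where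
  "ker_on W \<phi> = {w \<in> W. \<phi> w = 0}"

definition ordered_basis :: "('k::field ^ 'e::finite) set \<Rightarrow> ('k ^ 'e) list \<Rightarrow> bool" where
  "ordered_basis W ws \<longleftrightarrow>
     distinct ws \<and> vec.independent (set ws) \<and> vec.span (set ws) = W"

text \<open>\<open>det \<alpha>\<^sub>W\<^sub>,\<^sub>S\<close> with respect to the basis \<open>ws\<close> of \<open>W\<close>. It is meaningful only for
  \<open>card S = length ws\<close>; otherwise the matrix is not square and the value is \<open>0\<close>.\<close>

definition det_alpha :: "('k::field ^ 'e::{finite,linorder}) list \<Rightarrow> 'e set \<Rightarrow> 'k" where
  "det_alpha ws S =
     Determinant.det (Matrix.mat (length ws) (card S)
       (\<lambda>(i, j). (ws ! i) $ (sorted_list_of_set S ! j)))"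

text \<open>Polynomials in the variables \<open>x\<^sub>e\<close>, as finitely supported functions from exponent
  vectors to coefficients.\<close>

type_synonym ('e, 'k) mpoly = "('e \<Rightarrow>\<^sub>0 nat) \<Rightarrow>\<^sub>0 'k"

definition Const :: "'k::field \<Rightarrow> ('e, 'k) mpoly" where
  "Const a = Poly_Mapping.single 0 a"

definition Var :: "'e \<Rightarrow> ('e, 'k::field) mpoly" where
  "Var e = Poly_Mapping.single (Poly_Mapping.single e 1) 1"

definition sqfree_monom :: "'e::finite set \<Rightarrow> ('e, 'k::field) mpoly" where
  "sqfree_monom S = (\<Prod>e\<in>S. Var e)"

text \<open>The configuration polynomial of \<open>W\<close> normalized by the basis \<open>ws\<close>; the general
  representative is \<open>c\<^sup>2\<close> times it, with \<open>c \<noteq> 0\<close>. For \<open>W = 0\<close> the only basis is the empty list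
  and the value is \<open>1\<close>.\<close>

definition config_poly ::
  "('k::field ^ 'e::{finite,linorder}) set \<Rightarrow> ('k ^ 'e::{finite,linorder}) list \<Rightarrow> ('e, 'k) mpoly" where
  "config_poly W ws =
     (\<Sum>B\<in>matroid_bases (config_indep W). Const ((det_alpha ws B)\<^sup>2) * sqfree_monom B)"

end

theory Submission
  imports Defs
begin

text \<open>
  Let \<open>n = rk M - 1 = dim (ker \<phi>)\<close> and \<open>card S = n\<close>. Put the column \<open>(\<phi>(w\<^sup>i))\<^sub>i\<close> in front of the
  columns of the basis \<open>ws\<close> of \<open>W\<close> that are indexed by \<open>S\<close>, and let \<open>D(S)\<close> be the determinant of the
  resulting square matrix. Computing \<open>D(S)\<close> in two ways gives the theorem.

  First, on \<open>W\<close> the functional \<open>\<phi>\<close> is the sum of the \<open>\<phi>'(e) e\<^sup>\<or>\<close>, so the first column is a linear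
  combination of all coordinate columns. The columns \<open>e \<in> S\<close> contribute a repeated column, hence
  \<open>0\<close>; for \<open>e \<notin> S\<close>, sorting \<open>e\<close> into \<open>S\<close> moves it past the \<open>s \<in> S\<close> with \<open>s < e\<close>, which is the sign in
  the formula. So \<open>D(S)\<close> is the inner sum (\<open>laplace_sum_eq_det\<close>).

  Second, if \<open>vs\<close> is a basis of \<open>ker \<phi>\<close> and \<open>\<phi> w \<noteq> 0\<close>, then \<open>vs @ [w]\<close> is a basis of \<open>W\<close>
  (\<open>ordered_basis_ker_snoc\<close>), and replacing \<open>ws\<close> by it changes \<open>D(S)\<close> only by the determinant of the
  transition matrix, a nonzero scalar independent of \<open>S\<close> (\<open>ordered_basis_transition\<close>). For the new
  basis the column of \<open>\<phi>\<close> has the single nonzero entry \<open>\<phi> w\<close>, so expanding along it leaves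
  \<open>\<plusminus>\<phi> w\<close> times \<open>det_alpha vs S\<close> (\<open>det_eval_mat_last\<close>).

  Hence the inner sum is \<open>c * det_alpha vs S\<close> with the same \<open>c \<noteq> 0\<close> for all \<open>S\<close>. It remains to compare
  index sets: the bases of the matroid of a configuration are exactly the sets \<open>S\<close> of size its
  dimension with \<open>det_alpha vs S \<noteq> 0\<close> (\<open>config_bases_iff\<close>), so \<open>config_poly\<close> may be summed over all
  sets of that size (\<open>config_poly_eq_sum_card\<close>). This is elementary linear algebra, reduced to the
  fact that a homogeneous linear system with fewer equations than unknowns has a nontrivial
  solution.
\<close>

section \<open>Determinants of evaluation matrices\<close>

text \<open>Columns are arbitrary functionals, so that \<open>\<phi>\<close> and the coordinates \<open>e\<^sup>\<or>\<close> can be treated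
  alike.\<close>

definition eval_mat :: "'a list \<Rightarrow> ('a \<Rightarrow> 'k) list \<Rightarrow> 'k Matrix.mat" where
  "eval_mat us fs = Matrix.mat (length us) (length fs) (\<lambda>(i, j). (fs ! j) (us ! i))"

definition remove_nth :: "nat \<Rightarrow> 'a list \<Rightarrow> 'a list" where
  "remove_nth i us = take i us @ drop (Suc i) us"

lemma eval_mat_carrier [simp]:
  "eval_mat us fs \<in> carrier_mat (length us) (length fs)"
  by (simp add: eval_mat_def)

text \<open>This is Laplace expansion along the column of \<open>f\<close>; the exponent is the sum of the row index and the
  column index of an entry.\<close>

lemma det_eval_mat_expand:
  fixes us :: "'a list" and f :: "'a \<Rightarrow> 'k::field"
  assumes len: "length us = Suc (length fs + length gs)"
  shows "Determinant.det (eval_mat us (fs @ f # gs)) =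
    (\<Sum>i<length us. f (us ! i) * ((-1) ^ (i + length fs) *
       Determinant.det (eval_mat (remove_nth i us) (fs @ gs))))"
proof -
  let ?A = "eval_mat us (fs @ f # gs)"
  have A: "?A \<in> carrier_mat (length us) (length us)"
    using len eval_mat_carrier[of us "fs @ f # gs"] by simp
  have minor: "mat_delete ?A i (length fs) = eval_mat (remove_nth i us) (fs @ gs)"
    if i: "i < length us" for i
    using i len
    by (intro eq_matI) (auto simp: mat_delete_def eval_mat_def remove_nth_def nth_append min_def
        Suc_diff_le)
  have "Determinant.det ?A = (\<Sum>i<length us. ?A $$ (i, length fs) * cofactor ?A i (length fs))"
    by (rule laplace_expansion_column[OF A]) (simp add: len)
  then show ?thesis
    by (simp add: cofactor_def minor) (simp add: eval_mat_def nth_append len)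
qed

text \<open>The Laplace expansions of both determinants along the column of \<open>f\<close> have the same minors; only the
  cofactor signs differ, by the number of columns that \<open>f\<close> has passed.\<close>

lemma det_eval_mat_move_to_front:
  fixes us :: "'a list" and f :: "'a \<Rightarrow> 'k::field"
  assumes "length us = Suc (length fs + length gs)"
  shows "Determinant.det (eval_mat us (f # fs @ gs)) =
    (-1) ^ length fs * Determinant.det (eval_mat us (fs @ f # gs))"
proof -
  have "Determinant.det (eval_mat us (f # fs @ gs)) =
      (\<Sum>i<length us. f (us ! i) * ((-1) ^ i *
         Determinant.det (eval_mat (remove_nth i us) (fs @ gs))))"
    using det_eval_mat_expand[of us "[]" "fs @ gs" f] assms by simp
  also have "\<dots> = (-1) ^ length fs * Determinant.det (eval_mat us (fs @ f # gs))"
    unfolding det_eval_mat_expand[OF assms] sum_distrib_left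
    by (intro sum.cong) (auto simp: power_add simp flip: power_mult_distrib)
  finally show ?thesis .
qed

lemma det_eval_mat_linear_first:
  fixes us :: "'a list" and f :: "'a \<Rightarrow> 'k::field"
  assumes "length us = Suc (length fs)"
    and f: "\<And>u. u \<in> set us \<Longrightarrow> f u = (\<Sum>e\<in>I. c e * g e u)"
  shows "Determinant.det (eval_mat us (f # fs)) =
    (\<Sum>e\<in>I. c e * Determinant.det (eval_mat us (g e # fs)))"
proof -
  let ?m = "\<lambda>i. (-1) ^ i * Determinant.det (eval_mat (remove_nth i us) fs)"
  have expand: "Determinant.det (eval_mat us (h # fs)) = (\<Sum>i<length us. h (us ! i) * ?m i)" for h
    using det_eval_mat_expand[of us "[]" fs h] assms(1) by simp
  have "(\<Sum>i<length us. f (us ! i) * ?m i) = (\<Sum>i<length us. \<Sum>e\<in>I. c e * (g e (us ! i) * ?m i))"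
    by (intro sum.cong refl) (simp add: f sum_distrib_right mult.assoc)
  also have "\<dots> = (\<Sum>e\<in>I. \<Sum>i<length us. c e * (g e (us ! i) * ?m i))"
    by (rule sum.swap)
  finally show ?thesis
    unfolding expand sum_distrib_left .
qed

lemma det_eval_mat_repeated:
  fixes us :: "'a list" and f :: "'a \<Rightarrow> 'k::field"
  assumes "length us = Suc (length fs)" and "f \<in> set fs"
  shows "Determinant.det (eval_mat us (f # fs)) = 0"
proof -
  obtain j where j: "j < length fs" "fs ! j = f"
    using assms(2) by (auto simp: in_set_conv_nth)
  have A: "eval_mat us (f # fs) \<in> carrier_mat (length us) (length us)"
    using assms(1) eval_mat_carrier[of us "f # fs"] by simp
  have "col (eval_mat us (f # fs)) 0 = col (eval_mat us (f # fs)) (Suc j)"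
    using j by (intro eq_vecI) (auto simp: eval_mat_def)
  then show ?thesis
    using det_identical_columns[OF A, of 0 "Suc j"] j assms(1) by simp
qed

text \<open>All but the last entry of the first column vanish, so its Laplace expansion has a single
  term.\<close>

lemma det_eval_mat_last:
  fixes us :: "'a list" and f :: "'a \<Rightarrow> 'k::field"
  assumes "length us = length fs" and "\<And>u. u \<in> set us \<Longrightarrow> f u = 0"
  shows "Determinant.det (eval_mat (us @ [w]) (f # fs)) =
    (-1) ^ length us * f w * Determinant.det (eval_mat us fs)"
proof -
  have "Determinant.det (eval_mat (us @ [w]) (f # fs)) =
      (\<Sum>i<Suc (length us). f ((us @ [w]) ! i) * ((-1) ^ i *
         Determinant.det (eval_mat (remove_nth i (us @ [w])) fs)))"
    using det_eval_mat_expand[of "us @ [w]" "[]" fs f] assms(1) by simp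
  then show ?thesis
    by (simp add: nth_append remove_nth_def assms(2))
qed

text \<open>The position of \<open>e\<close> among the sorted columns of \<open>insert e S\<close> is \<open>length lo\<close>; this is the source of
  the sign exponent \<open>card {s\<in>S. s < e}\<close>.\<close>

lemma sorted_list_of_set_split:
  fixes S :: "'e::linorder set"
  assumes "finite S" and "e \<notin> S"
  defines "lo \<equiv> filter (\<lambda>s. s < e) (sorted_list_of_set S)"
    and "hi \<equiv> filter (\<lambda>s. e < s) (sorted_list_of_set S)"
  shows "sorted_list_of_set (insert e S) = lo @ e # hi"
    and "sorted_list_of_set S = lo @ hi"
proof -
  have "set lo = {s\<in>S. s < e}" "set hi = {s\<in>S. e < s}"
    using assms(1) by (auto simp: lo_def hi_def)
  moreover have "{s\<in>S. s < e} \<union> {s\<in>S. e < s} = S"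
    using assms(2) neq_iff by blast
  ultimately have "set (lo @ hi) = S"
    by simp
  moreover have "sorted (lo @ e # hi)" "sorted (lo @ hi)" "distinct (lo @ e # hi)" "distinct (lo @ hi)"
    unfolding lo_def hi_def using assms(1,2)
    by (auto simp: sorted_append sorted_wrt_filter)
  ultimately show "sorted_list_of_set (insert e S) = lo @ e # hi" "sorted_list_of_set S = lo @ hi"
    using sorted_list_of_set.idem_if_sorted_distinct[of "lo @ e # hi"]
      sorted_list_of_set.idem_if_sorted_distinct[of "lo @ hi"]
    by (simp_all del: sorted_list_of_set_insert_remove)
qed

section \<open>The inner sum as a determinant\<close>

lemma det_alpha_eq_eval_mat:
  "det_alpha ws S = Determinant.det (eval_mat ws (map (\<lambda>e w. w $ e) (sorted_list_of_set S)))"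
  unfolding det_alpha_def eval_mat_def
  by (intro arg_cong[where f = Determinant.det] eq_matI) auto

lemma det_alpha_insert:
  fixes ws :: "('k::field ^ 'e::{finite,linorder}) list"
  assumes "e \<notin> S" and len: "length ws = Suc (card S)"
  shows "(-1) ^ card {s\<in>S. s < e} * det_alpha ws (insert e S) =
    Determinant.det (eval_mat ws ((\<lambda>w. w $ e) # map (\<lambda>e w. w $ e) (sorted_list_of_set S)))"
proof -
  let ?x = "\<lambda>e (w :: 'k ^ 'e::{finite,linorder}). w $ e"
  let ?lo = "filter (\<lambda>s. s < e) (sorted_list_of_set S)"
  let ?hi = "filter (\<lambda>s. e < s) (sorted_list_of_set S)"
  note split = sorted_list_of_set_split[OF finite assms(1)]
  have card: "length ?lo = card {s\<in>S. s < e}"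
    by (subst distinct_card[symmetric]) (auto intro: arg_cong[where f = card])
  have "length ?lo + length ?hi = card S"
    by (metis length_append split(2) length_sorted_list_of_set)
  then have "Determinant.det (eval_mat ws (?x e # map ?x ?lo @ map ?x ?hi)) =
      (-1) ^ length ?lo * Determinant.det (eval_mat ws (map ?x ?lo @ ?x e # map ?x ?hi))"
    using det_eval_mat_move_to_front[of ws "map ?x ?lo" "map ?x ?hi"] len by simp
  then show ?thesis
    unfolding det_alpha_eq_eval_mat split(1) card
    by (subst split(2)) simp
qed

text \<open>Expand the functional \<open>\<phi>\<close> in the coordinates and use linearity of the determinant in the first
  column. The indices \<open>e \<in> S\<close>, absent from the sum, would contribute matrices with two equal
  columns.\<close>

lemma laplace_sum_eq_det:
  fixes ws :: "('k::field ^ 'e::{finite,linorder}) list"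
  assumes lin: "Vector_Spaces.linear (*s) (*) \<phi>"
    and len: "length ws = Suc (card S)"
  shows "(\<Sum>e\<in>UNIV - S. (-1) ^ card {s\<in>S. s < e} * \<phi> (axis e 1) * det_alpha ws (S \<union> {e})) =
    Determinant.det (eval_mat ws (\<phi> # map (\<lambda>e w. w $ e) (sorted_list_of_set S)))"
proof -
  let ?x = "\<lambda>e (w :: 'k ^ 'e::{finite,linorder}). w $ e"
  let ?fs = "map ?x (sorted_list_of_set S)"
  interpret \<phi>: Vector_Spaces.linear "(*s)" "(*)" \<phi> by (rule lin)
  have \<phi>: "\<phi> w = (\<Sum>e\<in>UNIV. \<phi> (axis e 1) * w $ e)" for w
  proof -
    have "\<phi> w = \<phi> (\<Sum>e\<in>UNIV. w $ e *s axis e 1)" by (simp only: basis_expansion)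
    also have "\<dots> = (\<Sum>e\<in>UNIV. \<phi> (axis e 1) * w $ e)"
      by (simp only: \<phi>.sum \<phi>.scale mult.commute)
    finally show ?thesis .
  qed
  have "Determinant.det (eval_mat ws (\<phi> # ?fs)) =
      (\<Sum>e\<in>UNIV. \<phi> (axis e 1) * Determinant.det (eval_mat ws (?x e # ?fs)))"
    using len by (intro det_eval_mat_linear_first) (simp, rule \<phi>)
  also have "\<dots> = (\<Sum>e\<in>UNIV - S. \<phi> (axis e 1) * Determinant.det (eval_mat ws (?x e # ?fs)))"
    using len by (intro sum.mono_neutral_right) (auto intro!: det_eval_mat_repeated)
  also have "\<dots> = (\<Sum>e\<in>UNIV - S. (-1) ^ card {s\<in>S. s < e} * \<phi> (axis e 1) * det_alpha ws (S \<union> {e}))"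
    using len by (intro sum.cong) (auto simp: det_alpha_insert[symmetric])
  finally show ?thesis by simp
qed

section \<open>Coordinates with respect to a basis, and change of basis\<close>

lemma sum_set_eq_sum_nth:
  "distinct xs \<Longrightarrow> (\<Sum>x\<in>set xs. f x) = (\<Sum>i<length xs. f (xs ! i))"
  by (rule sum.reindex_bij_betw[symmetric]) (rule bij_betw_nth; simp)

lemma ordered_basis_coeffs:
  assumes "ordered_basis W ws" and "w \<in> W"
  obtains c where "w = (\<Sum>i<length ws. c i *s (ws ! i))"
proof -
  from assms have "w \<in> vec.span (set ws)" "distinct ws"
    by (auto simp: ordered_basis_def)
  then obtain u where "w = (\<Sum>v\<in>set ws. u v *s v)"
    by (auto simp: vec.span_finite)
  with \<open>distinct ws\<close> have "w = (\<Sum>i<length ws. u (ws ! i) *s (ws ! i))"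
    by (simp add: sum_set_eq_sum_nth)
  then show ?thesis by (rule that)
qed

lemma ordered_basis_unique:
  assumes "ordered_basis W ws" and "(\<Sum>i<length ws. c i *s (ws ! i)) = 0" and "i < length ws"
  shows "c i = 0"
proof -
  from assms(1) have dist: "distinct ws" and ind: "vec.independent (set ws)"
    by (auto simp: ordered_basis_def)
  \<comment> \<open>Linear independence of a set speaks of coefficients indexed by vectors; \<open>u\<close> reindexes \<open>c\<close> that way,
    which is possible because the entries of \<open>ws\<close> are distinct.\<close>
  define u where "u v = c (THE j. j < length ws \<and> ws ! j = v)" for v
  have u: "u (ws ! j) = c j" if "j < length ws" for j
    unfolding u_def using that dist
    by (intro arg_cong[where f = c] the_equality) (auto simp: nth_eq_iff_index_eq)
  have "(\<Sum>v\<in>set ws. u v *s v) = 0"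
    using assms(2) by (simp add: sum_set_eq_sum_nth[OF dist] u)
  then have "u (ws ! i) = 0"
    using vec.independentD[OF ind, of "set ws" u "ws ! i"] assms(3) by auto
  then show ?thesis using u assms(3) by simp
qed

lemma ordered_basis_mem:
  "ordered_basis W ws \<Longrightarrow> i < length ws \<Longrightarrow> ws ! i \<in> W"
  by (auto simp: ordered_basis_def intro: vec.span_base)

lemma ordered_basis_length: "ordered_basis W ws \<Longrightarrow> length ws = vec.dim W"
  unfolding ordered_basis_def
  by (metis distinct_card vec.dim_span vec.dim_eq_card_independent)

lemma ordered_basis_subspace: "ordered_basis W ws \<Longrightarrow> vec.subspace W"
  by (auto simp: ordered_basis_def)

lemma dual_sum:
  fixes n :: nat
  assumes "f \<in> dual W" and W: "vec.subspace W" and us: "\<And>j. j < n \<Longrightarrow> u j \<in> W"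
  shows "f (\<Sum>j<n. c j *s u j) = (\<Sum>j<n. c j * f (u j))"
proof -
  have add: "\<And>x y. x \<in> W \<Longrightarrow> y \<in> W \<Longrightarrow> f (x + y) = f x + f y"
    and scale: "\<And>a x. x \<in> W \<Longrightarrow> f (a *s x) = a * f x"
    using assms(1) by (auto simp: dual_def)
  have "f 0 = 0"
    using scale[of 0 0] vec.subspace_0[OF W] by simp
  then show ?thesis
    using us
  proof (induction n)
    case (Suc n)
    have "(\<Sum>j<n. c j *s u j) \<in> W" "c n *s u n \<in> W"
      using Suc.prems W by (auto intro!: vec.subspace_sum vec.subspace_scale)
    then show ?case
      using Suc by (simp add: add scale)
  qed simp
qed

text \<open>For functionals that are linear on \<open>W\<close>, passing from \<open>us\<close> to \<open>ws\<close> multiplies the evaluation matrix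
  from the left by the transition matrix. Its determinant is nonzero because
  the product with the transition matrix in the other direction is the identity. The point is that
  the factor \<open>a\<close> is the same for all lists of functionals.\<close>

lemma ordered_basis_transition:
  fixes W :: "('k::field ^ 'e::finite) set"
  assumes us: "ordered_basis W us" and ws: "ordered_basis W ws"
  obtains a where "a \<noteq> 0"
    and "\<And>fs. set fs \<subseteq> dual W \<Longrightarrow> length fs = length ws \<Longrightarrow>
      Determinant.det (eval_mat ws fs) = a * Determinant.det (eval_mat us fs)"
proof -
  define n where "n = length ws"
  have n: "length ws = n" "length us = n"
    using ordered_basis_length[OF us] ordered_basis_length[OF ws] by (auto simp: n_def)
  note sub = ordered_basis_subspace[OF us]
  have "\<forall>i. \<exists>c. i < n \<longrightarrow> ws ! i = (\<Sum>j<n. c j *s (us ! j))"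
    using ordered_basis_coeffs[OF us ordered_basis_mem[OF ws]] n by metis
  then obtain C where C: "\<And>i. i < n \<Longrightarrow> ws ! i = (\<Sum>j<n. C i j *s (us ! j))"
    by metis
  have "\<forall>i. \<exists>c. i < n \<longrightarrow> us ! i = (\<Sum>j<n. c j *s (ws ! j))"
    using ordered_basis_coeffs[OF ws ordered_basis_mem[OF us]] n by metis
  then obtain D where D: "\<And>i. i < n \<Longrightarrow> us ! i = (\<Sum>j<n. D i j *s (ws ! j))"
    by metis
  let ?C = "Matrix.mat n n (\<lambda>(i, j). C i j)" and ?D = "Matrix.mat n n (\<lambda>(i, j). D i j)"
  have prod: "(\<Sum>j<n. C i j * D j k) = (if i = k then 1 else 0)" if "i < n" "k < n" for i k
  proof -
    have "ws ! i = (\<Sum>j<n. \<Sum>k<n. (C i j * D j k) *s (ws ! k))"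
    proof -
      have "ws ! i = (\<Sum>j<n. C i j *s (us ! j))" using that by (intro C)
      also have "\<dots> = (\<Sum>j<n. C i j *s (\<Sum>k<n. D j k *s (ws ! k)))"
        by (intro sum.cong refl) (simp flip: D)
      finally show ?thesis by (simp add: vec.scale_sum_right)
    qed
    also have "\<dots> = (\<Sum>k<n. (\<Sum>j<n. C i j * D j k) *s (ws ! k))"
      by (subst sum.swap) (simp add: vec.scale_sum_left)
    finally have "ws ! i = (\<Sum>k<n. (\<Sum>j<n. C i j * D j k) *s (ws ! k))" .
    moreover have "(\<Sum>k<n. (if i = k then 1 else 0) *s (ws ! k)) = ws ! i"
      using that by (simp add: if_distrib[of "\<lambda>c. c *s _"] cong: if_cong)
    ultimately have "(\<Sum>k<n. ((\<Sum>j<n. C i j * D j k) - (if i = k then 1 else 0)) *s (ws ! k)) = 0"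
      by (simp add: vec.scale_left_diff_distrib sum_subtractf)
    from ordered_basis_unique[OF ws, unfolded n, OF this] that show ?thesis
      by simp
  qed
  have "?C * ?D = 1\<^sub>m n"
    by (intro eq_matI) (auto simp: scalar_prod_def prod atLeast0LessThan)
  then have "Determinant.det ?C * Determinant.det ?D = 1"
    by (metis det_mult det_one mat_carrier)
  then have "Determinant.det ?C \<noteq> 0"
    by auto
  moreover have "Determinant.det (eval_mat ws fs) = Determinant.det ?C * Determinant.det (eval_mat us fs)"
    if fs: "set fs \<subseteq> dual W" "length fs = length ws" for fs
  proof -
    have "eval_mat ws fs = ?C * eval_mat us fs"
    proof (intro eq_matI)
      fix i k assume "i < dim_row (?C * eval_mat us fs)" "k < dim_col (?C * eval_mat us fs)"
      then have ik: "i < n" "k < n"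
        using fs n by (auto simp: eval_mat_def)
      then have "fs ! k \<in> dual W"
        using fs n by (metis nth_mem subsetD)
      then have "(fs ! k) (ws ! i) = (\<Sum>j<n. C i j * (fs ! k) (us ! j))"
        using C[OF ik(1)] dual_sum[OF _ sub] ordered_basis_mem[OF us] n by simp
      then show "eval_mat ws fs $$ (i, k) = (?C * eval_mat us fs) $$ (i, k)"
        using ik fs n by (simp add: eval_mat_def scalar_prod_def atLeast0LessThan)
    qed (use fs n in \<open>auto simp: eval_mat_def\<close>)
    then show ?thesis
      using det_mult[of ?C n "eval_mat us fs"] eval_mat_carrier[of us fs] fs n by simp
  qed
  ultimately show ?thesis by (rule that)
qed

section \<open>Bases of the matroid of a configuration\<close>

lemma det_0_iff_nontrivial_solution:
  fixes a :: "nat \<Rightarrow> nat \<Rightarrow> 'k::field"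
  shows "Determinant.det (Matrix.mat n n (\<lambda>(i, j). a i j)) = 0 \<longleftrightarrow>
    (\<exists>c. (\<exists>j<n. c j \<noteq> 0) \<and> (\<forall>i<n. (\<Sum>j<n. a i j * c j) = 0))"
    (is "Determinant.det ?A = 0 \<longleftrightarrow> ?R")
proof -
  have "Determinant.det ?A = 0 \<longleftrightarrow>
      (\<exists>v. v \<in> carrier_vec n \<and> v \<noteq> 0\<^sub>v n \<and> ?A *\<^sub>v v = 0\<^sub>v n)"
    by (rule det_0_iff_vec_prod_zero) simp
  also have "\<dots> \<longleftrightarrow> ?R"
  proof
    assume "\<exists>v. v \<in> carrier_vec n \<and> v \<noteq> 0\<^sub>v n \<and> ?A *\<^sub>v v = 0\<^sub>v n"
    then obtain v where v: "v \<in> carrier_vec n" "v \<noteq> 0\<^sub>v n" "?A *\<^sub>v v = 0\<^sub>v n" by blast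
    have "\<exists>j<n. vec_index v j \<noteq> 0"
      using v(1,2) by (auto intro!: eq_vecI)
    moreover have "(\<Sum>j<n. a i j * vec_index v j) = 0" if "i < n" for i
      using arg_cong[OF v(3), of "\<lambda>x. vec_index x i"] that v(1)
      by (simp add: scalar_prod_def atLeast0LessThan)
    ultimately show ?R by blast
  next
    assume ?R
    then obtain c where c: "\<exists>j<n. c j \<noteq> 0" "\<forall>i<n. (\<Sum>j<n. a i j * c j) = 0" by blast
    have "Matrix.vec n c \<noteq> 0\<^sub>v n"
      using c(1) by (metis index_vec index_zero_vec(1))
    moreover have "?A *\<^sub>v Matrix.vec n c = 0\<^sub>v n"
      using c(2) by (intro eq_vecI) (auto simp: scalar_prod_def atLeast0LessThan)
    ultimately show "\<exists>v. v \<in> carrier_vec n \<and> v \<noteq> 0\<^sub>v n \<and> ?A *\<^sub>v v = 0\<^sub>v n"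
      by (intro exI[of _ "Matrix.vec n c"]) simp
  qed
  finally show ?thesis .
qed

text \<open>Padding the system with zero equations makes it square with determinant \<open>0\<close>.\<close>

lemma underdetermined_system_solution:
  fixes a :: "nat \<Rightarrow> nat \<Rightarrow> 'k::field"
  assumes "m < n"
  obtains c where "\<exists>j<n. c j \<noteq> 0" and "\<And>i. i < m \<Longrightarrow> (\<Sum>j<n. a i j * c j) = 0"
proof -
  define a' where "a' i j = (if i < m then a i j else 0)" for i j
  let ?A = "Matrix.mat n n (\<lambda>(i, j). a' i j)"
  have "Determinant.det ?A = (\<Sum>j<n. ?A $$ (m, j) * cofactor ?A m j)"
    using assms by (intro laplace_expansion_row) auto
  also have "\<dots> = 0"
    using assms by (intro sum.neutral) (simp add: a'_def)
  finally obtain c where c: "\<exists>j<n. c j \<noteq> 0" "\<forall>i<n. (\<Sum>j<n. a' i j * c j) = 0"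
    unfolding det_0_iff_nontrivial_solution by blast
  have "(\<Sum>j<n. a i j * c j) = 0" if "i < m" for i
    using c(2)[rule_format, of i] that assms by (simp add: a'_def)
  with c(1) show ?thesis by (rule that)
qed

text \<open>By linearity, a relation between coordinate functions holds on \<open>W\<close> as soon as it holds on a basis.
  Thus independence of the family is triviality of the kernel of the matrix that defines
  \<open>det_alpha\<close>, here with the elements of \<open>S\<close> numbered in increasing order.\<close>

lemma config_indep_iff_columns:
  fixes W :: "('k::field ^ 'e::{finite,linorder}) set"
  assumes ws: "ordered_basis W ws"
  shows "config_indep W S \<longleftrightarrow>
    (\<forall>c. (\<forall>i<length ws. (\<Sum>j<card S. (ws ! i) $ (sorted_list_of_set S ! j) * c j) = 0) \<longrightarrow>
      (\<forall>j<card S. c j = 0))" (is "_ \<longleftrightarrow> ?R")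
proof -
  let ?xs = "sorted_list_of_set S"
  have S: "S = set ?xs" "distinct ?xs" "length ?xs = card S" by auto
  have sum_S: "(\<Sum>e\<in>S. h e) = (\<Sum>j<card S. h (?xs ! j))" for h :: "'e \<Rightarrow> 'k"
    using sum_set_eq_sum_nth[OF S(2), of h] by simp
  show ?thesis
  proof
    assume ind: "config_indep W S"
    show ?R
    proof (intro allI impI)
      fix c j
      assume c: "\<forall>i<length ws. (\<Sum>j<card S. (ws ! i) $ (?xs ! j) * c j) = 0" and j: "j < card S"
      \<comment> \<open>\<open>d\<close> is \<open>c\<close>, reindexed by the elements of \<open>S\<close> instead of their positions.\<close>
      define d where "d e = c (THE j. j < card S \<and> ?xs ! j = e)" for e
      have d: "d (?xs ! j) = c j" if "j < card S" for j
        unfolding d_def using that S(2,3)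
        by (intro arg_cong[where f = c] the_equality) (auto simp: nth_eq_iff_index_eq)
      have "(\<Sum>e\<in>S. d e * w $ e) = 0" if w: "w \<in> W" for w
      proof -
        obtain b where b: "w = (\<Sum>i<length ws. b i *s (ws ! i))"
          by (rule ordered_basis_coeffs[OF ws w])
        have "(\<Sum>e\<in>S. d e * w $ e) =
            (\<Sum>j<card S. \<Sum>i<length ws. b i * ((ws ! i) $ (?xs ! j) * c j))"
          unfolding sum_S b
          by (intro sum.cong) (auto simp: d sum_distrib_left mult_ac)
        also have "\<dots> = (\<Sum>i<length ws. b i * (\<Sum>j<card S. (ws ! i) $ (?xs ! j) * c j))"
          by (subst sum.swap) (simp add: sum_distrib_left)
        also have "\<dots> = 0" using c by simp
        finally show ?thesis .
      qed
      moreover have "?xs ! j \<in> S"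
        using j S by (metis nth_mem)
      ultimately have "d (?xs ! j) = 0"
        using ind by (auto simp: config_indep_def)
      then show "c j = 0" using d j by simp
    qed
  next
    assume R: ?R
    show "config_indep W S"
      unfolding config_indep_def
    proof (intro allI impI ballI)
      fix c e
      assume c: "\<forall>w\<in>W. (\<Sum>e\<in>S. c e * w $ e) = 0" and e: "e \<in> S"
      have "(\<Sum>j<card S. (ws ! i) $ (?xs ! j) * c (?xs ! j)) = 0" if "i < length ws" for i
        using c ordered_basis_mem[OF ws that] by (simp add: sum_S mult.commute)
      then have "\<forall>j<card S. c (?xs ! j) = 0" using R[rule_format, of "\<lambda>j. c (?xs ! j)"] by blast
      then show "c e = 0" using e S by (metis in_set_conv_nth)
    qed
  qed
qed

lemma config_indep_card_le:
  fixes W :: "('k::field ^ 'e::{finite,linorder}) set"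
  assumes ws: "ordered_basis W ws" and "config_indep W S"
  shows "card S \<le> length ws"
proof (rule ccontr)
  assume "\<not> card S \<le> length ws"
  then have "length ws < card S" by simp
  then obtain c where "\<exists>j<card S. c j \<noteq> 0"
    "\<And>i. i < length ws \<Longrightarrow> (\<Sum>j<card S. (ws ! i) $ (sorted_list_of_set S ! j) * c j) = 0"
    by (rule underdetermined_system_solution[where a = "\<lambda>i j. (ws ! i) $ (sorted_list_of_set S ! j)"]) blast
  with assms(2) show False
    unfolding config_indep_iff_columns[OF ws] by blast
qed

text \<open>If \<open>card S < dim W\<close>, some nonzero \<open>w \<in> W\<close> vanishes on \<open>S\<close>. Any coordinate \<open>f\<close> with \<open>w $ f \<noteq> 0\<close> can
  be added to \<open>S\<close>: evaluating a relation at \<open>w\<close> shows that the coefficient of \<open>f\<close> is \<open>0\<close>.\<close>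

lemma config_indep_extend:
  fixes W :: "('k::field ^ 'e::{finite,linorder}) set"
  assumes ws: "ordered_basis W ws" and ind: "config_indep W S" and "card S < length ws"
  obtains f where "f \<notin> S" and "config_indep W (insert f S)"
proof -
  let ?xs = "sorted_list_of_set S"
  from assms(3) obtain b where b: "\<exists>i<length ws. b i \<noteq> 0"
    and b0: "\<And>j. j < card S \<Longrightarrow> (\<Sum>i<length ws. (ws ! i) $ (?xs ! j) * b i) = 0"
    by (rule underdetermined_system_solution[where a = "\<lambda>j i. (ws ! i) $ (sorted_list_of_set S ! j)"]) blast
  define w where "w = (\<Sum>i<length ws. b i *s (ws ! i))"
  have "w \<in> W"
    unfolding w_def using ordered_basis_subspace[OF ws] ordered_basis_mem[OF ws]
    by (auto intro!: vec.subspace_sum vec.subspace_scale)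
  have wS: "w $ e = 0" if e: "e \<in> S" for e
  proof -
    obtain j where "j < card S" "?xs ! j = e"
      using e in_set_conv_nth[of e ?xs] by auto
    then show ?thesis using b0[of j] by (simp add: w_def mult.commute)
  qed
  have "w \<noteq> 0"
    using ordered_basis_unique[OF ws, of b] b by (auto simp: w_def)
  then obtain f where f: "w $ f \<noteq> 0" by (auto simp: vec_eq_iff)
  then have "f \<notin> S" using wS by blast
  moreover have "config_indep W (insert f S)"
    unfolding config_indep_def
  proof (intro allI impI)
    fix c assume c: "\<forall>v\<in>W. (\<Sum>e\<in>insert f S. c e * v $ e) = 0"
    have "c f * w $ f = 0"
      using c \<open>w \<in> W\<close> \<open>f \<notin> S\<close> by (force simp: wS)
    then have "c f = 0" using f by simp
    moreover have "\<forall>e\<in>S. c e = 0"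
      using ind c \<open>f \<notin> S\<close> \<open>c f = 0\<close> by (auto simp: config_indep_def)
    ultimately show "\<forall>e\<in>insert f S. c e = 0" by simp
  qed
  ultimately show ?thesis by (rule that)
qed

lemma config_indep_iff_det_alpha:
  fixes W :: "('k::field ^ 'e::{finite,linorder}) set"
  assumes ws: "ordered_basis W ws" and card: "card S = length ws"
  shows "config_indep W S \<longleftrightarrow> det_alpha ws S \<noteq> 0"
  using det_0_iff_nontrivial_solution[of "length ws" "\<lambda>i j. (ws ! i) $ (sorted_list_of_set S ! j)"]
  unfolding config_indep_iff_columns[OF ws] det_alpha_def card by blast

text \<open>A maximal independent set has full size, since a smaller one could be extended. Conversely an
  independent set of size \<open>dim W\<close> is maximal, as no larger set is independent.\<close>

lemma config_bases_iff:
  fixes W :: "('k::field ^ 'e::{finite,linorder}) set"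
  assumes ws: "ordered_basis W ws"
  shows "B \<in> matroid_bases (config_indep W) \<longleftrightarrow> card B = length ws \<and> det_alpha ws B \<noteq> 0"
proof
  assume "B \<in> matroid_bases (config_indep W)"
  then have ind: "config_indep W B" and max: "\<And>S. config_indep W S \<Longrightarrow> B \<subseteq> S \<Longrightarrow> S = B"
    by (auto simp: matroid_bases_def)
  have "card B = length ws"
  proof (rule ccontr)
    assume "card B \<noteq> length ws"
    then have "card B < length ws" using config_indep_card_le[OF ws ind] by simp
    then obtain f where "f \<notin> B" "config_indep W (insert f B)"
      by (rule config_indep_extend[OF ws ind])
    then show False using max[of "insert f B"] by blast
  qed
  then show "card B = length ws \<and> det_alpha ws B \<noteq> 0"
    using ind config_indep_iff_det_alpha[OF ws] by blast
next
  assume B: "card B = length ws \<and> det_alpha ws B \<noteq> 0"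
  then have "config_indep W B" using config_indep_iff_det_alpha[OF ws] by blast
  moreover have "S = B" if "config_indep W S" "B \<subseteq> S" for S
    using config_indep_card_le[OF ws that(1)] B that(2) by (metis card_seteq finite)
  ultimately show "B \<in> matroid_bases (config_indep W)"
    by (auto simp: matroid_bases_def)
qed

lemma matroid_rank_eq_length:
  fixes W :: "('k::field ^ 'e::{finite,linorder}) set"
  assumes "realizes W M" and ws: "ordered_basis W ws"
  shows "matroid_rank M = length ws"
proof -
  have M: "M = config_indep W" using assms(1) by (auto simp: realizes_def)
  let ?C = "card ` {S. config_indep W S}"
  have "config_indep W {}" by (simp add: config_indep_def)
  then have "Max ?C \<in> ?C" by (intro Max_in) auto
  then obtain S where S: "config_indep W S" "card S = Max ?C" by auto
  have "\<not> card S < length ws"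
  proof
    assume "card S < length ws"
    then obtain f where f: "f \<notin> S" "config_indep W (insert f S)"
      by (rule config_indep_extend[OF ws S(1)])
    then have "card (insert f S) \<le> Max ?C" by (intro Max_ge imageI) auto
    then show False using f(1) S(2) by simp
  qed
  then show ?thesis
    using config_indep_card_le[OF ws S(1)] S(2) by (simp add: M matroid_rank_def)
qed

text \<open>The sets of the right size that are not bases have \<open>det_alpha ws S = 0\<close>, so they may be added to the
  sum.\<close>

lemma config_poly_eq_sum_card:
  fixes W :: "('k::field ^ 'e::{finite,linorder}) set"
  assumes "ordered_basis W ws"
  shows "config_poly W ws =
    (\<Sum>S | card S = length ws. Const ((det_alpha ws S)\<^sup>2) * sqfree_monom S)"
  unfolding config_poly_def
  by (intro sum.mono_neutral_left) (auto simp: config_bases_iff[OF assms] Const_def)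

section \<open>The configuration polynomial of a kernel\<close>

lemma ordered_basis_ker_snoc:
  assumes W: "vec.subspace W" and \<phi>: "\<phi> \<in> dual W" and w: "w \<in> W" "\<phi> w \<noteq> 0"
    and vs: "ordered_basis (ker_on W \<phi>) vs"
  shows "ordered_basis W (vs @ [w])"
proof -
  from vs have vs': "distinct vs" "vec.independent (set vs)" "vec.span (set vs) = ker_on W \<phi>"
    by (auto simp: ordered_basis_def)
  have notin: "w \<notin> vec.span (set vs)" using vs'(3) w by (simp add: ker_on_def)
  have "vec.span (insert w (set vs)) = W"
  proof
    show "vec.span (insert w (set vs)) \<subseteq> W"
      using W w(1) vs'(3) vec.span_superset[of "set vs"]
      by (intro vec.span_minimal) (auto simp: ker_on_def)
    show "W \<subseteq> vec.span (insert w (set vs))"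
    proof
      fix x assume x: "x \<in> W"
      \<comment> \<open>Subtracting this multiple of \<open>w\<close> projects \<open>x\<close> onto the kernel.\<close>
      let ?c = "\<phi> x / \<phi> w"
      have "\<phi> (x + (- ?c) *s w) = \<phi> x + (- ?c) * \<phi> w"
      proof -
        have "(- ?c) *s w \<in> W" by (rule vec.subspace_scale[OF W w(1)])
        then have "\<phi> (x + (- ?c) *s w) = \<phi> x + \<phi> ((- ?c) *s w)"
          using \<phi> x unfolding dual_def by blast
        also have "\<phi> ((- ?c) *s w) = (- ?c) * \<phi> w"
          using \<phi> w(1) unfolding dual_def by blast
        finally show ?thesis .
      qed
      also have "\<dots> = 0" using w(2) by simp
      finally have "x + (- ?c) *s w \<in> ker_on W \<phi>"
        using W x w(1) by (auto simp: ker_on_def intro!: vec.subspace_diff vec.subspace_scale)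
      then have "x - ?c *s w \<in> vec.span (set vs)" by (simp add: vs'(3))
      then show "x \<in> vec.span (insert w (set vs))" by (auto simp: vec.span_insert)
    qed
  qed
  moreover have "w \<notin> set vs" using notin vec.span_base by blast
  ultimately show ?thesis
    using vs'(1) vec.independent_insertI[OF notin vs'(2)] by (simp add: ordered_basis_def)
qed

theorem proposition3p14:
  fixes W :: "('k::field ^ 'e::{finite,linorder}) set"
    and M :: "'e set \<Rightarrow> bool"
    and \<phi> \<phi>' :: "'k ^ 'e::{finite,linorder} \<Rightarrow> 'k"
    and ws vs :: "('k ^ 'e::{finite,linorder}) list"
  assumes "realizes W M"
    and "\<phi> \<in> dual W" and "\<exists>w\<in>W. \<phi> w \<noteq> 0"
    and "Vector_Spaces.linear (*s) (*) \<phi>'" and "\<forall>w\<in>W. \<phi>' w = \<phi> w"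
    and "ordered_basis W ws"
    and "ordered_basis (ker_on W \<phi>) vs"
  shows "\<exists>c. c \<noteq> 0 \<and>
    Const (c\<^sup>2) * config_poly (ker_on W \<phi>) vs =
      (\<Sum>S | card S = matroid_rank M - 1.
         Const ((\<Sum>e\<in>UNIV - S. (-1) ^ card {s\<in>S. s < e} *
                   \<phi>' (axis e 1) * det_alpha ws (S \<union> {e}))\<^sup>2) * sqfree_monom S)"
proof -
  from assms(3) obtain w where w: "w \<in> W" "\<phi> w \<noteq> 0" by blast
  have W: "vec.subspace W" using assms(1) by (simp add: realizes_def)
  have basis: "ordered_basis W (vs @ [w])"
    by (rule ordered_basis_ker_snoc[OF W assms(2) w assms(7)])
  have len: "length ws = Suc (length vs)"
    using ordered_basis_length[OF basis] ordered_basis_length[OF assms(6)] by simp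
  obtain a where a: "a \<noteq> 0" and change: "\<And>fs. set fs \<subseteq> dual W \<Longrightarrow> length fs = length ws \<Longrightarrow>
      Determinant.det (eval_mat ws fs) = a * Determinant.det (eval_mat (vs @ [w]) fs)"
    by (rule ordered_basis_transition[OF basis assms(6)]) blast
  \<comment> \<open>The factors are the change of basis from \<open>vs @ [w]\<close> to \<open>ws\<close>, the sign of the entry \<open>\<phi>' w\<close> in the
    last row of the first column, and that entry.\<close>
  define c where "c = a * ((-1) ^ length vs * \<phi>' w)"
  have "c \<noteq> 0" using a w assms(5) by (simp add: c_def)
  have coeff: "(\<Sum>e\<in>UNIV - S. (-1) ^ card {s\<in>S. s < e} * \<phi>' (axis e 1) * det_alpha ws (S \<union> {e})) =
      c * det_alpha vs S" if S: "card S = length vs" for S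
  proof -
    let ?fs = "map (\<lambda>e (w :: 'k ^ 'e::{finite,linorder}). w $ e) (sorted_list_of_set S)"
    have "\<phi>' \<in> dual W"
      using assms(2,5) W unfolding dual_def
      by (auto simp: vec.subspace_add vec.subspace_scale)
    then have dual: "set (\<phi>' # ?fs) \<subseteq> dual W"
      by (auto simp: dual_def)
    have ker: "\<phi>' v = 0" if "v \<in> set vs" for v
    proof -
      have "v \<in> ker_on W \<phi>"
        using assms(7) that by (auto simp: ordered_basis_def intro: vec.span_base)
      then show ?thesis using assms(5) by (simp add: ker_on_def)
    qed
    have "(\<Sum>e\<in>UNIV - S. (-1) ^ card {s\<in>S. s < e} * \<phi>' (axis e 1) * det_alpha ws (S \<union> {e})) =
        Determinant.det (eval_mat ws (\<phi>' # ?fs))"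
      using S len by (intro laplace_sum_eq_det[OF assms(4)]) simp
    also have "\<dots> = a * Determinant.det (eval_mat (vs @ [w]) (\<phi>' # ?fs))"
      using S len by (intro change[OF dual]) simp
    also have "Determinant.det (eval_mat (vs @ [w]) (\<phi>' # ?fs)) =
        (-1) ^ length vs * \<phi>' w * Determinant.det (eval_mat vs ?fs)"
      using S ker by (intro det_eval_mat_last) auto
    finally show ?thesis
      by (simp add: c_def det_alpha_eq_eval_mat mult.assoc)
  qed
  have Const_mult: "Const (x * y) = Const x * (Const y :: ('e, 'k) mpoly)" for x y
    by (simp add: Const_def mult_single)
  have "Const (c\<^sup>2) * config_poly (ker_on W \<phi>) vs =
      (\<Sum>S | card S = length vs. Const ((c * det_alpha vs S)\<^sup>2) * sqfree_monom S)"
    unfolding config_poly_eq_sum_card[OF assms(7)] sum_distrib_left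
    by (simp add: power_mult_distrib Const_mult mult.assoc)
  also have "\<dots> = (\<Sum>S | card S = matroid_rank M - 1.
         Const ((\<Sum>e\<in>UNIV - S. (-1) ^ card {s\<in>S. s < e} *
                   \<phi>' (axis e 1) * det_alpha ws (S \<union> {e}))\<^sup>2) * sqfree_monom S)"
    using matroid_rank_eq_length[OF assms(1,6)] len by (intro sum.cong) (auto simp flip: coeff)
  finally show ?thesis using \<open>c \<noteq> 0\<close> by blast
qed

end
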